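(* Let $\widehat{\alpha}$ and $\widehat{\beta}$ be two dual space curves in $\mathbb{D}^3$. If $\widehat{\alpha}$ and $\widehat{\beta}$ are Bertrand curves, then the dual angle between the tangent vectors of $\widehat\alpha$ and $\widehat\beta$ at corresponding points is constant.
   Context: Dual numbers: $\mathbb{D}=\{\widehat a=a+\varepsilon a^*: a,a^*\in\mathbb{R}\}$ with $\varepsilon^2=0$, a commutative ring under $(a+\varepsilon a^* )+(b+\varepsilon b^* )=(a+b)+\varepsilon(a^*+b^* )$ and $(a+\varepsilon a^* )(b+\varepsilon b^* )=ab+\varepsilon(ab^*+ba^* )$. A dual number is pure-dual if its real part $a$ is $0$. For a dual number $\phi=\varphi+\varepsilon\varphi^*$, $\cos\phi=\cos\varphi-\varepsilon\varphi^*\sin\varphi$ and $\sin\phi=\sin\varphi+\varepsilon\varphi^*\cos\varphi$. $\mathbb{D}^3$ is the $\mathbb{D}$-module of dual vectors $\widehat a=a+\varepsilon a^*$ with $a,a^*\in\mathbb{R}^3$. Inner product: $\langle\widehat a,\widehat b\rangle=\langle a,b\rangle+\varepsilon(\langle a,b^*\rangle+\langle a^*,b\rangle)$. The cross product is given by the usual coordinate formula with dual entries. Norm: $\|\widehat a\|=\sqrt{\langle\widehat a,\widehat a\rangle}=\|a\|+\varepsilon\frac{\langle a,a^*\rangle}{\|a\|}$ for $a\neq0$. A dual space curve is a map $\widehat\alpha:I\subset\mathbb{D}\to\mathbb{D}^3$, $\widehat\alpha(s)=\alpha(s)+\varepsilon\alpha^*(s)$, with $\alpha,\alpha^*$ differentiable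 vector functions. With respect to its dual arc-length parameter, its Frenet frame $\{\widehat T,\widehat N,\widehat B\}$ (unit tangent, unit principal normal, $\widehat B=\widehat T\times\widehat N$), curvature $\widehat\kappa$ and torsion $\widehat\tau$ (both $\mathbb{D}$-valued and nowhere pure-dual) satisfy $\widehat T=\widehat\alpha'$, $\widehat T'=\widehat\kappa\widehat N$, $\widehat N'=-\widehat\kappa\widehat T+\widehat\tau\widehat B$, $\widehat B'=-\widehat\tau\widehat N$. Curves are assumed regular enough for these to exist. Bertrand curves: $\widehat\alpha$ and $\widehat\beta$ are called Bertrand curves if there is a correspondence between their points such that the principal normal vectors of $\widehat\alpha$ and $\widehat\beta$ at corresponding points are linearly dependent (each is a multiple of the other by a dual number). Let $s$ be the arc-length parameter of $\widehat\alpha$, with Frenet frame $\{\widehat T(s),\widehat N(s),\widehat B(s)\}$, and let $\widehat{T^\circ}(s)$ be the unit tangent of $\widehat\beta$ at the point corresponding to $\widehat\alpha(s)$. The dual angle between the tangent vectors at corresponding points is the dual number $\phi=\varphi+\varepsilon\varphi^*$ (a function of $s$, taken to vary differentiably) with $\widehat{T^\circ}(s)=\cos\phi\,\widehat T(s)+\sin\phi\,\widehat B(s)$. *)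

theory Defs
  imports "HOL-Analysis.Analysis"
begin

section \<open>Dual numbers\<close>

text \<open>\<^term>\<open>Dual a b\<close> stands for \<open>a + \<epsilon> b\<close> with \<open>\<epsilon>\<^sup>2 = 0\<close>.\<close>

datatype dual = Dual (real_part: real) (dual_part: real)

lemma dual_eq_iff: "x = y \<longleftrightarrow> real_part x = real_part y \<and> dual_part x = dual_part y"
  by (cases x; cases y) simp

instantiation dual :: comm_ring_1
begin

definition "0 = Dual 0 0"
definition "1 = Dual 1 0"
definition "x + y = Dual (real_part x + real_part y) (dual_part x + dual_part y)"
definition "- x = Dual (- real_part x) (- dual_part x)"
definition "x - y = Dual (real_part x - real_part y) (dual_part x - dual_part y)"
definition "x * y = Dual (real_part x * real_part y)
  (real_part x * dual_part y + dual_part x * real_part y)"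

instance
  by standard
    (simp_all add: zero_dual_def one_dual_def plus_dual_def uminus_dual_def minus_dual_def
      times_dual_def algebra_simps)

end

lemma dual_parts [simp]:
  "real_part 0 = 0" "dual_part 0 = 0"
  "real_part 1 = 1" "dual_part 1 = 0"
  "real_part (x + y) = real_part x + real_part y"
  "dual_part (x + y) = dual_part x + dual_part y"
  "real_part (- x) = - real_part x"
  "dual_part (- x) = - dual_part x"
  "real_part (x - y) = real_part x - real_part y"
  "dual_part (x - y) = dual_part x - dual_part y"
  "real_part (x * y) = real_part x * real_part y"
  "dual_part (x * y) = real_part x * dual_part y + dual_part x * real_part y"
  by (simp_all add: zero_dual_def one_dual_def plus_dual_def uminus_dual_def minus_dual_def
      times_dual_def)

instantiation dual :: real_algebra_1
begin

definition "r *\<^sub>R x = Dual (r * real_part x) (r * dual_part x)" for x :: dual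

instance
  by standard (simp_all add: dual_eq_iff scaleR_dual_def algebra_simps)

end

text \<open>The real-valued norm below only fixes the topology of the plane of dual numbers, as needed
  for limits and derivatives.  The sum norm is used because it is submultiplicative.\<close>

instantiation dual :: real_normed_algebra_1
begin

definition "norm x = \<bar>real_part x\<bar> + \<bar>dual_part x\<bar>" for x :: dual
definition "sgn x = x /\<^sub>R norm x" for x :: dual
definition "dist x y = norm (x - y)" for x y :: dual
definition uniformity_dual_def [code del]:
  "(uniformity :: (dual \<times> dual) filter) = (INF e\<in>{0 <..}. principal {(x, y). dist x y < e})"
definition open_dual_def [code del]:
  "open (U :: dual set) \<longleftrightarrow> (\<forall>x\<in>U. eventually (\<lambda>(x', y). x' = x \<longrightarrow> y \<in> U) uniformity)"

instance
proof
  fix r :: real and x y :: dual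
  show "norm (1 :: dual) = 1"
    by (simp add: norm_dual_def)
  show "norm x = 0 \<longleftrightarrow> x = 0"
    by (auto simp: norm_dual_def dual_eq_iff)
  show "norm (x + y) \<le> norm x + norm y"
    by (simp add: norm_dual_def)
  show "norm (r *\<^sub>R x) = \<bar>r\<bar> * norm x"
    by (simp add: norm_dual_def scaleR_dual_def abs_mult algebra_simps)
  have "\<bar>real_part x * dual_part y + dual_part x * real_part y\<bar>
      \<le> \<bar>real_part x\<bar> * \<bar>dual_part y\<bar> + \<bar>dual_part x\<bar> * \<bar>real_part y\<bar>"
    by (metis abs_mult abs_triangle_ineq)
  then show "norm (x * y) \<le> norm x * norm y"
    unfolding norm_dual_def by (simp add: abs_mult algebra_simps add_increasing)
qed (rule sgn_dual_def dist_dual_def open_dual_def uniformity_dual_def)+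

end

lemma dual_parts_scaleR [simp]:
  "real_part (r *\<^sub>R x) = r * real_part x" "dual_part (r *\<^sub>R x) = r * dual_part x"
  by (simp_all add: scaleR_dual_def)

lemma dual_parts_of_real [simp]: "real_part (of_real r) = r" "dual_part (of_real r) = 0"
  by (simp_all add: of_real_def)

definition pure_dual :: "dual \<Rightarrow> bool"
  where "pure_dual x \<longleftrightarrow> real_part x = 0"

definition dual_cos :: "dual \<Rightarrow> dual"
  where "dual_cos x = Dual (cos (real_part x)) (- dual_part x * sin (real_part x))"

definition dual_sin :: "dual \<Rightarrow> dual"
  where "dual_sin x = Dual (sin (real_part x)) (dual_part x * cos (real_part x))"


section \<open>Dual vectors\<close>

text \<open>The module of dual vectors is \<^typ>\<open>dual ^ 3\<close>, with scalar multiplication \<^term>\<open>(*s)\<close>.\<close>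

definition vec_real_part :: "dual ^ 3 \<Rightarrow> real ^ 3"
  where "vec_real_part v = (\<chi> i. real_part (v $ i))"

definition vec_dual_part :: "dual ^ 3 \<Rightarrow> real ^ 3"
  where "vec_dual_part v = (\<chi> i. dual_part (v $ i))"

definition dual_inner :: "dual ^ 3 \<Rightarrow> dual ^ 3 \<Rightarrow> dual"
  where "dual_inner v w =
    Dual (vec_real_part v \<bullet> vec_real_part w)
         (vec_real_part v \<bullet> vec_dual_part w + vec_dual_part v \<bullet> vec_real_part w)"

text \<open>Only meaningful for vectors with nonzero real part; a vector whose \<open>dual_norm\<close> is 1 has one.\<close>

definition dual_norm :: "dual ^ 3 \<Rightarrow> dual"
  where "dual_norm v =
    Dual (norm (vec_real_part v))
         (vec_real_part v \<bullet> vec_dual_part v / norm (vec_real_part v))"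

definition dual_cross :: "dual ^ 3 \<Rightarrow> dual ^ 3 \<Rightarrow> dual ^ 3"
  where "dual_cross v w = vector
    [v $ 2 * w $ 3 - v $ 3 * w $ 2,
     v $ 3 * w $ 1 - v $ 1 * w $ 3,
     v $ 1 * w $ 2 - v $ 2 * w $ 1]"

lemma dual_norm_mult_self: "dual_norm v * dual_norm v = dual_inner v v"
  by (cases "vec_real_part v = 0")
    (simp_all add: dual_norm_def dual_inner_def dual_eq_iff inner_commute
      power2_norm_eq_inner [symmetric] power2_eq_square)

definition dual_parallel :: "dual ^ 3 \<Rightarrow> dual ^ 3 \<Rightarrow> bool"
  where "dual_parallel v w \<longleftrightarrow> (\<exists>c. v = c *s w) \<and> (\<exists>c. w = c *s v)"


section \<open>Dual space curves\<close>

text \<open>As for complex derivatives, \<open>v\<close> is the derivative with respect to a dual parameter if the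
  differential is multiplication by \<open>v\<close>, that is, \<open>f (s + h) - f s = h *s v + o(h)\<close>.\<close>

definition has_dual_derivative ::
    "(dual \<Rightarrow> dual ^ 3) \<Rightarrow> dual ^ 3 \<Rightarrow> dual \<Rightarrow> dual set \<Rightarrow> bool"
  where "has_dual_derivative f v s I \<longleftrightarrow> (f has_derivative (\<lambda>h. h *s v)) (at s within I)"

text \<open>Parameter domains.  They may be one-dimensional, since the dual arc length of a curve given by
  a real parameter traces an arc in the plane of dual numbers.  The first condition says that each
  point is approached within the domain in a direction that is not pure-dual; this makes dual
  derivatives unique, which would fail along a pure-dual line because pure-dual numbers are zero
  divisors.\<close>

definition dual_domain :: "dual set \<Rightarrow> bool"
  where "dual_domain I \<longleftrightarrow> I \<noteq> {} \<and>
    (\<forall>s\<in>I. \<exists>c. s islimpt {t \<in> I. norm (t - s) \<le> c * \<bar>real_part (t - s)\<bar>}) \<and>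
    (\<forall>x\<in>I. \<forall>y\<in>I. \<exists>\<gamma>. valid_path \<gamma> \<and> path_image \<gamma> \<subseteq> I \<and> pathstart \<gamma> = x \<and> pathfinish \<gamma> = y)"

text \<open>A dual space curve \<open>\<alpha>\<close> parametrized by its dual arc length on \<open>I\<close>, together with its Frenet
  apparatus.\<close>

definition dual_frenet_curve ::
    "dual set \<Rightarrow> (dual \<Rightarrow> dual ^ 3) \<Rightarrow> (dual \<Rightarrow> dual ^ 3) \<Rightarrow> (dual \<Rightarrow> dual ^ 3) \<Rightarrow>
      (dual \<Rightarrow> dual ^ 3) \<Rightarrow> (dual \<Rightarrow> dual) \<Rightarrow> (dual \<Rightarrow> dual) \<Rightarrow> bool"
  where "dual_frenet_curve I \<alpha> T N B \<kappa> \<tau> \<longleftrightarrow>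
    dual_domain I \<and>
    (\<forall>s\<in>I.
      dual_norm (T s) = 1 \<and> dual_norm (N s) = 1 \<and> dual_inner (T s) (N s) = 0 \<and>
      B s = dual_cross (T s) (N s) \<and>
      \<not> pure_dual (\<kappa> s) \<and> \<not> pure_dual (\<tau> s) \<and>
      has_dual_derivative \<alpha> (T s) s I \<and>
      has_dual_derivative T (\<kappa> s *s N s) s I \<and>
      has_dual_derivative N (- (\<kappa> s) *s T s + \<tau> s *s B s) s I \<and>
      has_dual_derivative B (- (\<tau> s) *s N s) s I)"

text \<open>\<open>g\<close> sends the parameter of a point of the first curve (domain \<open>I\<close>, principal normal \<open>N\<close>) to
  the parameter of the corresponding point of the second one (domain \<open>J\<close>, principal normal \<open>M\<close>).
  Two curves are Bertrand curves if such a \<open>g\<close> exists; no regularity or injectivity is required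
  of it.\<close>

definition bertrand_correspondence ::
    "dual set \<Rightarrow> (dual \<Rightarrow> dual ^ 3) \<Rightarrow> dual set \<Rightarrow> (dual \<Rightarrow> dual ^ 3) \<Rightarrow> (dual \<Rightarrow> dual) \<Rightarrow> bool"
  where "bertrand_correspondence I N J M g \<longleftrightarrow>
    g ` I = J \<and> (\<forall>s\<in>I. dual_parallel (N s) (M (g s)))"

definition dual_tangent_angle ::
    "dual set \<Rightarrow> (dual \<Rightarrow> dual ^ 3) \<Rightarrow> (dual \<Rightarrow> dual ^ 3) \<Rightarrow> (dual \<Rightarrow> dual ^ 3) \<Rightarrow>
      (dual \<Rightarrow> dual) \<Rightarrow> (dual \<Rightarrow> dual) \<Rightarrow> bool"
  where "dual_tangent_angle I T B U g \<phi> \<longleftrightarrow>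
    \<phi> differentiable_on I \<and>
    (\<forall>s\<in>I. U (g s) = dual_cos (\<phi> s) *s T s + dual_sin (\<phi> s) *s B s)"


subsection \<open>Examples of parameter domains\<close>

lemma dual_domain_open:
  fixes I :: "dual set"
  assumes I: "open I" "connected I" "I \<noteq> {}"
  shows "dual_domain I"
  unfolding dual_domain_def
proof (intro conjI ballI)
  show "I \<noteq> {}" by fact
next
  fix s assume "s \<in> I"
  have "s islimpt {t \<in> I. norm (t - s) \<le> 1 * \<bar>real_part (t - s)\<bar>}"
    unfolding islimpt_approachable
  proof (intro allI impI)
    fix e :: real assume "e > 0"
    obtain d where d: "d > 0" "ball s d \<subseteq> I"
      using \<open>open I\<close> \<open>s \<in> I\<close> open_contains_ball by metis
    define r where "r = min d e / 2"
    have r: "r > 0" "r < d" "r < e"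
      using d(1) \<open>e > 0\<close> by (auto simp: r_def)
    have "dist (s + of_real r) s = r" "dist s (s + of_real r) = r" "s + of_real r \<noteq> s"
      using r by (auto simp: dist_norm dual_eq_iff)
    with d r show "\<exists>x'\<in>{t \<in> I. norm (t - s) \<le> 1 * \<bar>real_part (t - s)\<bar>}. x' \<noteq> s \<and> dist x' s < e"
      by (intro bexI [of _ "s + of_real r"]) auto
  qed
  then show "\<exists>c. s islimpt {t \<in> I. norm (t - s) \<le> c * \<bar>real_part (t - s)\<bar>}" ..
next
  fix x y assume xy: "x \<in> I" "y \<in> I"
  define h where "h z = Dual (Re z) (Im z)" for z
  define k where "k u = Complex (real_part u) (dual_part u)" for u
  have hk: "h (k u) = u" "k (h z) = z" for u z
    by (simp_all add: h_def k_def)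
  interpret h: bounded_linear h
  proof (rule bounded_linear_intro [where K = 2])
    show "norm (h z) \<le> norm z * 2" for z
      using abs_Re_le_cmod [of z] abs_Im_le_cmod [of z] by (simp add: h_def norm_dual_def)
  qed (simp_all add: h_def dual_eq_iff)
  interpret k: bounded_linear k
  proof (rule bounded_linear_intro [where K = 1])
    show "norm (k z) \<le> norm z * 1" for z
      using cmod_le [of "k z"] by (simp add: k_def norm_dual_def)
  qed (simp_all add: k_def complex_eq_iff)
  have kI: "k ` I = h -` I"
    using hk by (auto simp: image_iff) metis
  have "open (k ` I)"
    unfolding kI using \<open>open I\<close> by (intro open_vimage h.continuous_on continuous_on_id)
  moreover have "connected (k ` I)"
    using \<open>connected I\<close> by (intro connected_continuous_image k.continuous_on continuous_on_id)
  ultimately obtain p where p: "polynomial_function p" "path_image p \<subseteq> k ` I"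
      "pathstart p = k x" "pathfinish p = k y"
    using connected_open_polynomial_connected [of "k ` I" "k x" "k y"] xy by blast
  obtain p' where p': "polynomial_function p'" "\<And>t. (p has_vector_derivative p' t) (at t)"
    using has_vector_derivative_polynomial_function [OF p(1)] by blast
  have "((h \<circ> p) has_vector_derivative h (p' t)) (at t)" for t
    unfolding o_def by (rule h.has_vector_derivative [OF p'(2)])
  moreover have "continuous_on {0..1} (\<lambda>t. h (p' t))"
    using p'(1) by (intro h.continuous_on) (simp add: continuous_on_polymonial_function)
  ultimately have "(h \<circ> p) C1_differentiable_on {0..1}"
    unfolding C1_differentiable_on_def
    by (intro exI [of _ "\<lambda>t. h (p' t)"]) auto
  then have "valid_path (h \<circ> p)"
    by (simp add: valid_path_def C1_differentiable_imp_piecewise)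
  moreover have "path_image (h \<circ> p) \<subseteq> I" "pathstart (h \<circ> p) = x" "pathfinish (h \<circ> p) = y"
    using p(2-) hk kI by (auto simp: path_image_compose pathstart_compose pathfinish_compose)
  ultimately show "\<exists>\<gamma>. valid_path \<gamma> \<and> path_image \<gamma> \<subseteq> I \<and> pathstart \<gamma> = x \<and> pathfinish \<gamma> = y"
    by blast
qed

lemma dual_domain_real_interval:
  assumes "a < b"
  shows "dual_domain (of_real ` {a..b})"
  unfolding dual_domain_def
proof (intro conjI ballI)
  show "of_real ` {a..b} \<noteq> ({} :: dual set)"
    using assms by simp
next
  fix s :: dual assume "s \<in> of_real ` {a..b}"
  then obtain r where r: "s = of_real r" "r \<in> {a..b}" by blast
  have "r islimpt {a..b}"
    using assms r by (simp add: islimpt_Icc)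
  have "s islimpt {t \<in> of_real ` {a..b}. norm (t - s) \<le> 1 * \<bar>real_part (t - s)\<bar>}"
    unfolding islimpt_approachable
  proof (intro allI impI)
    fix e :: real assume "e > 0"
    with \<open>r islimpt {a..b}\<close> obtain u where "u \<in> {a..b}" "u \<noteq> r" "dist u r < e"
      unfolding islimpt_approachable by blast
    then show "\<exists>x'\<in>{t \<in> of_real ` {a..b}. norm (t - s) \<le> 1 * \<bar>real_part (t - s)\<bar>}.
        x' \<noteq> s \<and> dist x' s < e"
      by (intro bexI [of _ "of_real u"])
        (auto simp: r dist_norm norm_dual_def dual_eq_iff)
  qed
  then show "\<exists>c. s islimpt {t \<in> of_real ` {a..b}. norm (t - s) \<le> c * \<bar>real_part (t - s)\<bar>}" ..
next
  fix x y :: dual assume "x \<in> of_real ` {a..b}" "y \<in> of_real ` {a..b}"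
  then obtain u v where uv: "x = of_real u" "y = of_real v" "u \<in> {a..b}" "v \<in> {a..b}" by blast
  define \<gamma> where "\<gamma> = linepath x y"
  have "(\<gamma> has_vector_derivative (y - x)) (at t)" for t
    unfolding \<gamma>_def by (rule has_vector_derivative_linepath_within)
  then have "\<gamma> C1_differentiable_on {0..1}"
    unfolding C1_differentiable_on_def
    by (intro exI [of _ "\<lambda>_. y - x"]) auto
  then have "valid_path \<gamma>"
    by (simp add: valid_path_def C1_differentiable_imp_piecewise)
  moreover have "path_image \<gamma> \<subseteq> of_real ` {a..b}"
  proof
    fix z assume "z \<in> path_image \<gamma>"
    then obtain t where t: "t \<in> {0..1}" "z = of_real ((1 - t) *\<^sub>R u + t *\<^sub>R v)"
      by (auto simp: \<gamma>_def path_image_def linepath_def uv scaleR_conv_of_real)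
    have "(1 - t) *\<^sub>R u + t *\<^sub>R v \<in> {a..b}"
      using t uv(3,4) by (intro convexD [OF convex_real_interval(5)]) auto
    with t show "z \<in> of_real ` {a..b}" by blast
  qed
  moreover have "pathstart \<gamma> = x" "pathfinish \<gamma> = y"
    by (simp_all add: \<gamma>_def)
  ultimately show "\<exists>\<gamma>. valid_path \<gamma> \<and> path_image \<gamma> \<subseteq> of_real ` {a..b} \<and>
      pathstart \<gamma> = x \<and> pathfinish \<gamma> = y"
    by blast
qed

end

theory Submission
  imports Defs
begin

text \<open>
  Write the tangent of the second curve at the corresponding point as
  \<open>U (g s) = cos \<phi> T + sin \<phi> B\<close>.  By the Frenet formulas the derivative of the right-hand side is
  \<open>\<phi>' (- sin \<phi> T + cos \<phi> B)\<close> plus a multiple of \<open>N\<close>.  If \<open>g\<close> were differentiable, the derivative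
  of the left-hand side would be a multiple of the second principal normal, hence of \<open>N\<close>, and
  comparing the components along \<open>w = - sin \<phi> T + cos \<phi> B\<close> would give \<open>\<phi>' = 0\<close>.

  Since \<open>g\<close> is an arbitrary map, the comparison is made along sequences instead.  Follow a path
  \<open>\<gamma>\<close> in the domain and put \<open>t = g \<circ> \<gamma>\<close>.  The graph of \<open>t\<close> lies in a second countable space, so
  apart from countably many parameters \<open>r\<close> the point \<open>(r, t r)\<close> is a limit of other points
  \<open>(x n, t (x n))\<close> of the graph (\<open>countable_no_graph_accumulation\<close>).  The curvature of the second
  curve is invertible, so its tangent changes at a rate comparable to its parameter; as the tangent
  depends differentiably on \<open>r\<close>, the increments \<open>t (x n) - t r\<close> are \<open>O(x n - r)\<close>.  To first order
  in \<open>t (x n) - t r\<close> the tangent moves along the principal normal only, so its component along \<open>w\<close>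
  changes by \<open>o(x n - r)\<close> (\<open>vector_derivative_zero_of_stationary_composition\<close>).  Thus the
  derivative of \<open>\<phi> \<circ> \<gamma>\<close> vanishes outside a countable set, and a continuous function with this
  property is constant (\<open>eq_if_derivative_zero_off_countable\<close>).  Any two points of the domain are
  joined by such a path.
\<close>

section \<open>Real analysis\<close>

text \<open>Each such point is the only point of \<open>X\<close> in some member of a countable basis.\<close>

lemma countable_non_limit_points:
  fixes X :: "'a::second_countable_topology set"
  shows "countable {x \<in> X. \<not> x islimpt X}"
proof -
  obtain \<B> :: "'a set set" where \<B>: "countable \<B>" "topological_basis \<B>"
    using ex_countable_basis by blast
  have "\<exists>V\<in>\<B>. V \<inter> X = {x}" if x: "x \<in> X" "\<not> x islimpt X" for x
  proof -
    obtain W where W: "open W" "x \<in> W" "\<forall>y\<in>X. y \<in> W \<longrightarrow> y = x"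
      using x(2) unfolding islimpt_def by blast
    obtain V where V: "V \<in> \<B>" "x \<in> V" "V \<subseteq> W"
      by (rule topological_basisE [OF \<B>(2) W(1,2)])
    have "V \<inter> X = {x}"
      using V W(3) x(1) by blast
    with V(1) show ?thesis by blast
  qed
  then have "\<forall>x\<in>{x \<in> X. \<not> x islimpt X}. \<exists>V. V \<in> \<B> \<and> V \<inter> X = {x}"
    by blast
  then obtain V where V: "\<forall>x\<in>{x \<in> X. \<not> x islimpt X}. V x \<in> \<B> \<and> V x \<inter> X = {x}"
    by (rule bchoice [THEN exE])
  have "inj_on V {x \<in> X. \<not> x islimpt X}"
  proof (rule inj_onI)
    fix x y assume xy: "x \<in> {x \<in> X. \<not> x islimpt X}" "y \<in> {x \<in> X. \<not> x islimpt X}"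
      and eq: "V x = V y"
    have "{x} = V x \<inter> X" "{y} = V y \<inter> X"
      using xy V by simp_all
    with eq show "x = y" by (metis singleton_inject)
  qed
  moreover have "V ` {x \<in> X. \<not> x islimpt X} \<subseteq> \<B>"
    using V by auto
  ultimately show ?thesis
    using \<B>(1) by (meson countable_image_inj_on countable_subset)
qed

definition graph_accumulates ::
    "('a::topological_space \<Rightarrow> 'b::topological_space) \<Rightarrow> 'a set \<Rightarrow> 'a \<Rightarrow> bool"
  where "graph_accumulates t S r \<longleftrightarrow>
    (\<exists>x. (\<forall>n. x n \<in> S - {r}) \<and> x \<longlonglongrightarrow> r \<and> (\<lambda>n. t (x n)) \<longlonglongrightarrow> t r)"

text \<open>A substitute for continuity that costs nothing: however wild \<open>t\<close> is, all but countably many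
  points of its graph are limits of other points of the graph.\<close>

lemma countable_no_graph_accumulation:
  fixes t :: "'a::second_countable_topology \<Rightarrow> 'b::second_countable_topology"
  shows "countable {r \<in> S. \<not> graph_accumulates t S r}" (is "countable ?E")
proof -
  define X where "X = (\<lambda>r. (r, t r)) ` S"
  have "(r, t r) \<in> {z \<in> X. \<not> z islimpt X}" if r: "r \<in> ?E" for r
  proof -
    have "\<not> (r, t r) islimpt X"
    proof
      assume "(r, t r) islimpt X"
      then obtain z where z: "\<forall>n. z n \<in> X - {(r, t r)}" "z \<longlonglongrightarrow> (r, t r)"
        unfolding islimpt_sequential by blast
      have zz: "z n = (fst (z n), t (fst (z n)))" "fst (z n) \<in> S - {r}" for n
        using spec [OF z(1), of n] by (auto simp: X_def)
      have tz: "(\<lambda>n. t (fst (z n))) = (\<lambda>n. snd (z n))"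
        using arg_cong [OF zz(1), of snd] by (intro ext) simp
      have "(\<lambda>n. fst (z n)) \<longlonglongrightarrow> r"
        using tendsto_fst [OF z(2)] by simp
      moreover have "(\<lambda>n. t (fst (z n))) \<longlonglongrightarrow> t r"
        unfolding tz using tendsto_snd [OF z(2)] by simp
      ultimately have "graph_accumulates t S r"
        unfolding graph_accumulates_def using zz(2)
        by (intro exI [of _ "\<lambda>n. fst (z n)"] conjI allI)
      with r show False by simp
    qed
    with r show ?thesis by (auto simp: X_def)
  qed
  then have "(\<lambda>r. (r, t r)) ` ?E \<subseteq> {z \<in> X. \<not> z islimpt X}"
    by blast
  moreover have "inj_on (\<lambda>r. (r, t r)) ?E"
    by (rule inj_onI) simp
  ultimately show ?thesis
    using countable_non_limit_points [of X] by (meson countable_image_inj_on countable_subset)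
qed

text \<open>If \<open>f a < f b\<close>, then also \<open>h a < h b\<close> for \<open>h x = f x - f a - e (x - a)\<close> with a small \<open>e > 0\<close>.  The last
  point at which \<open>h\<close> takes a value \<open>c\<close> between \<open>h a\<close> and \<open>h b\<close> lies in \<open>K\<close>, because \<open>h\<close> exceeds
  \<open>c\<close> to the right of it, whereas outside \<open>K\<close> the derivative of \<open>h\<close> is \<open>- e\<close>.  Different values \<open>c\<close>
  give different points, and there are uncountably many \<open>c\<close>.\<close>

lemma le_if_derivative_zero_off_countable:
  fixes f :: "real \<Rightarrow> real"
  assumes "a \<le> b" and cont: "continuous_on {a..b} f" and K: "countable K"
    and der: "\<And>x. x \<in> {a..b} - K \<Longrightarrow> (f has_real_derivative 0) (at x within {a..b})"
  shows "f b \<le> f a"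
proof (rule ccontr)
  assume "\<not> f b \<le> f a"
  then have "a < b" and less: "f a < f b"
    using \<open>a \<le> b\<close> by (auto simp: order.order_iff_strict)
  \<comment> \<open>Half the slope of the secant, so that \<open>h b\<close> below is still positive.\<close>
  define e where "e = (f b - f a) / 2 / (b - a)"
  define h where "h x = f x - f a - e * (x - a)" for x
  have "e > 0" and ha: "h a = 0"
    using \<open>a < b\<close> less by (simp_all add: e_def h_def)
  have "e * (b - a) = (f b - f a) / 2"
    using \<open>a < b\<close> by (intro nonzero_eq_divide_eq [THEN iffD1, OF _ e_def]) simp
  then have hb: "h b = (f b - f a) / 2"
    by (simp add: h_def)
  have hcont: "continuous_on {a..b} h"
    unfolding h_def by (intro continuous_intros cont)
  have "\<exists>x\<in>K. h x = c" if c: "c \<in> {0<..<h b}" for c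
  proof -
    define L where "L = {x \<in> {a..b}. h x \<le> c}"
    have "compact L"
    proof -
      have "closed L"
        unfolding L_def
        by (rule continuous_on_closed_Collect_le [OF hcont continuous_on_const closed_atLeastAtMost])
      moreover have "bounded L"
        by (rule bounded_subset [OF bounded_closed_interval [of a b]]) (auto simp: L_def)
      ultimately show ?thesis
        by (simp add: compact_eq_bounded_closed)
    qed
    moreover have "L \<noteq> {}"
    proof -
      have "a \<in> L"
        using c \<open>a < b\<close> ha by (simp add: L_def)
      then show ?thesis by blast
    qed
    ultimately obtain x where x: "x \<in> L" "\<And>y. y \<in> L \<Longrightarrow> y \<le> x"
      using compact_attains_sup by metis
    have xab: "x \<in> {a..<b}" "h x \<le> c"
    proof -
      have "x \<noteq> b"
        using x(1) c by (auto simp: L_def)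
      with x(1) show "x \<in> {a..<b}" "h x \<le> c"
        by (simp_all add: L_def)
    qed
    have gt: "h y > c" if "x < y" "y \<le> b" for y
      using x(2) [of y] that xab(1) by (force simp: L_def)
    have "h x = c"
    proof (rule ccontr)
      assume "h x \<noteq> c"
      then have "h x < c" using xab by simp
      have "continuous_on {x..b} h"
        using hcont xab by (auto elim: continuous_on_subset)
      then obtain y where "x \<le> y" "y \<le> b" "h y = c"
        using IVT' [of h x c b] \<open>h x < c\<close> c xab by auto
      then show False
        using gt [of y] \<open>h x \<noteq> c\<close> by (cases "x = y") auto
    qed
    moreover have "x \<in> K"
    proof (rule ccontr)
      assume "x \<notin> K"
      then have "(h has_real_derivative - e) (at x within {a..b})"
        unfolding h_def using xab by (auto intro!: derivative_eq_intros der)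
      then obtain d where d: "d > 0" "\<And>k. 0 < k \<Longrightarrow> x + k \<in> {a..b} \<Longrightarrow> k < d \<Longrightarrow> h (x + k) < h x"
        using has_real_derivative_neg_dec_right [of h "- e" x "{a..b}"] \<open>e > 0\<close> by auto
      define k where "k = min (d / 2) (b - x)"
      have "0 < k" "k < d" "x + k \<le> b"
        using d(1) xab by (auto simp: k_def)
      then have "h (x + k) < h x" "h (x + k) > c"
        using d(2) [of k] gt [of "x + k"] xab by auto
      with \<open>h x = c\<close> show False by simp
    qed
    ultimately show ?thesis by blast
  qed
  then have "{0<..<h b} \<subseteq> h ` K"
    by blast
  then have "countable {0<..<h b}"
    using K by (meson countable_image countable_subset)
  then show False
    using uncountable_open_interval [of 0 "h b"] hb less by simp
qed

lemma eq_if_derivative_zero_off_countable: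
  fixes f :: "real \<Rightarrow> real"
  assumes "a \<le> b" "continuous_on {a..b} f" "countable K"
    and der: "\<And>x. x \<in> {a..b} - K \<Longrightarrow> (f has_real_derivative 0) (at x within {a..b})"
  shows "f b = f a"
proof (rule antisym)
  show "f b \<le> f a"
    using assms by (rule le_if_derivative_zero_off_countable)
  have "- f b \<le> - f a"
  proof (rule le_if_derivative_zero_off_countable [OF assms(1) _ assms(3)])
    show "continuous_on {a..b} (\<lambda>x. - f x)"
      using assms(2) by (rule continuous_on_minus)
    show "((\<lambda>x. - f x) has_real_derivative 0) (at x within {a..b})" if "x \<in> {a..b} - K" for x
      using DERIV_minus [OF der [OF that]] by simp
  qed
  then show "f a \<le> f b" by simp
qed

text \<open>A chain rule without differentiability of the inner function \<open>t\<close>.  Near \<open>t r\<close> the lower bound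
  on \<open>F'\<close> makes \<open>norm (t (x n) - t r)\<close> at most a constant times the increment of \<open>F \<circ> t\<close>, which is
  \<open>O(x n - r)\<close>; since \<open>Q\<close> is stationary at \<open>t r\<close>, the increment of \<open>Q \<circ> t\<close> is \<open>o(x n - r)\<close>.\<close>

lemma vector_derivative_zero_of_stationary_composition:
  fixes t :: "real \<Rightarrow> 'a::real_normed_vector"
    and F :: "'a \<Rightarrow> 'b::real_normed_vector" and Q :: "'a \<Rightarrow> 'c::real_normed_vector"
  assumes F: "(F has_derivative F') (at (t r) within J)"
    and c: "c > 0" "\<And>h. c * norm h \<le> norm (F' h)"
    and Q: "(Q has_derivative (\<lambda>h. 0)) (at (t r) within J)"
    and tJ: "t ` S \<subseteq> J"
    and Ft: "((\<lambda>y. F (t y)) has_vector_derivative a) (at r within S)"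
    and Qt: "((\<lambda>y. Q (t y)) has_vector_derivative p) (at r within S)"
    and x: "\<And>n. x n \<in> S - {r}" "x \<longlonglongrightarrow> r" "(\<lambda>n. t (x n)) \<longlonglongrightarrow> t r"
  shows "p = 0"
proof -
  have quot: "(\<lambda>n. norm (G (x n) - G r) / \<bar>x n - r\<bar>) \<longlonglongrightarrow> norm d"
    if "(G has_vector_derivative d) (at r within S)" for G :: "real \<Rightarrow> 'd::real_normed_vector" and d
  proof -
    have "((\<lambda>y. norm (G y - G r - (y - r) *\<^sub>R d) / norm (y - r)) \<longlongrightarrow> 0) (at r within S)"
      using that by (simp add: has_vector_derivative_def has_derivative_iff_norm)
    moreover have "filterlim x (at r within S) sequentially"
      using x by (auto simp: filterlim_at intro!: always_eventually)
    ultimately have "(\<lambda>n. norm (G (x n) - G r - (x n - r) *\<^sub>R d) / norm (x n - r)) \<longlonglongrightarrow> 0"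
      by (rule filterlim_compose)
    moreover have "norm (norm (G (x n) - G r) / \<bar>x n - r\<bar> - norm d)
        \<le> norm (G (x n) - G r - (x n - r) *\<^sub>R d) / norm (x n - r)" for n
    proof -
      have "norm d = norm ((x n - r) *\<^sub>R d) / \<bar>x n - r\<bar>"
        using x(1) [of n] by simp
      then have "\<bar>norm (G (x n) - G r) / \<bar>x n - r\<bar> - norm d\<bar> =
          \<bar>norm (G (x n) - G r) - norm ((x n - r) *\<^sub>R d)\<bar> / \<bar>x n - r\<bar>"
        by (metis abs_abs abs_divide diff_divide_distrib)
      also have "\<dots> \<le> norm (G (x n) - G r - (x n - r) *\<^sub>R d) / \<bar>x n - r\<bar>"
        by (intro divide_right_mono norm_triangle_ineq3) simp
      finally show ?thesis by simp
    qed
    ultimately have "(\<lambda>n. norm (G (x n) - G r) / \<bar>x n - r\<bar> - norm d) \<longlonglongrightarrow> 0"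
      by (rule Lim_null_comparison [OF always_eventually [OF allI], rotated])
    then show ?thesis by (rule LIM_zero_cancel)
  qed
  have bound: "norm p \<le> e * norm a" if "e > 0" for e
  proof -
    have near: "\<forall>\<^sub>F n in sequentially. norm (t (x n) - t r) < d" if "d > 0" for d
      using x(3) that by (simp add: tendsto_iff dist_norm)
    have "c / 2 > 0" "e * c / 2 > 0"
      using c(1) \<open>e > 0\<close> by simp_all
    obtain d where d: "d > 0" "\<And>y. y \<in> J \<Longrightarrow> norm (y - t r) < d \<Longrightarrow>
        norm (F y - F (t r) - F' (y - t r)) \<le> c / 2 * norm (y - t r)"
      using F \<open>c / 2 > 0\<close> unfolding has_derivative_within_alt by blast
    obtain d' where d': "d' > 0" "\<And>y. y \<in> J \<Longrightarrow> norm (y - t r) < d' \<Longrightarrow>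
        norm (Q y - Q (t r) - 0) \<le> e * c / 2 * norm (y - t r)"
      using Q \<open>e * c / 2 > 0\<close> unfolding has_derivative_within_alt by blast
    have "\<forall>\<^sub>F n in sequentially. norm (Q (t (x n)) - Q (t r)) / \<bar>x n - r\<bar>
        \<le> e * (norm (F (t (x n)) - F (t r)) / \<bar>x n - r\<bar>)"
      using near [OF d(1)] near [OF d'(1)]
    proof eventually_elim
      case (elim n)
      define h where "h = t (x n) - t r"
      have J: "t (x n) \<in> J"
        using x(1) [of n] tJ by auto
      have "c * norm h - norm (F (t (x n)) - F (t r)) \<le> c / 2 * norm h"
        using d(2) [OF J elim(1)] c(2) [of h] norm_triangle_ineq2 [of "F' h" "F (t (x n)) - F (t r)"]
        by (simp add: h_def norm_minus_commute)
      then have "c / 2 * norm h \<le> norm (F (t (x n)) - F (t r))"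
        by simp
      moreover have "norm (Q (t (x n)) - Q (t r)) \<le> e * (c / 2 * norm h)"
        using d'(2) [OF J elim(2)] by (simp add: h_def)
      ultimately have "norm (Q (t (x n)) - Q (t r)) \<le> e * norm (F (t (x n)) - F (t r))"
        using \<open>e > 0\<close> by (meson mult_le_cancel_left_pos order_trans)
      then show ?case
        by (simp add: divide_right_mono)
    qed
    then show ?thesis
      using tendsto_le [OF _ tendsto_mult_left [OF quot [OF Ft]] quot [OF Qt]] by simp
  qed
  have "norm p \<le> 0"
  proof (rule field_le_epsilon)
    fix e :: real assume "e > 0"
    have "norm p \<le> e / (norm a + 1) * norm a"
      using \<open>e > 0\<close> by (intro bound) (simp add: add_nonneg_pos)
    also have "\<dots> = e * (norm a / (norm a + 1))"
      by simp
    also have "\<dots> \<le> e * 1"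
      using \<open>e > 0\<close> by (intro mult_left_mono) (simp_all add: divide_le_eq_1 add_nonneg_pos)
    finally show "norm p \<le> 0 + e" by simp
  qed
  then show ?thesis by simp
qed


section \<open>Dual numbers and dual vectors\<close>

lemma bounded_linear_real_part: "bounded_linear real_part"
  by (rule bounded_linear_intro [where K = 1]) (simp_all add: norm_dual_def)

lemma bounded_linear_dual_part: "bounded_linear dual_part"
  by (rule bounded_linear_intro [where K = 1]) (simp_all add: norm_dual_def)

lemma bounded_linear_Dual: "bounded_linear (\<lambda>z. Dual (fst z) (snd z))"
proof (rule bounded_linear_intro [where K = 2])
  show "norm (Dual (fst z) (snd z)) \<le> norm z * 2" for z :: "real \<times> real"
    using norm_fst_le [of "fst z" "snd z"] norm_snd_le [of "snd z" "fst z"]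
    by (simp add: norm_dual_def)
qed (simp_all add: dual_eq_iff)

lemma tendsto_Dual:
  assumes "(f \<longlongrightarrow> a) F" "(g \<longlongrightarrow> b) F"
  shows "((\<lambda>x. Dual (f x) (g x)) \<longlongrightarrow> Dual a b) F"
  using bounded_linear.tendsto [OF bounded_linear_Dual tendsto_Pair [OF assms]] by simp

lemma has_vector_derivative_dual_iff:
  "(f has_vector_derivative d) (at x within S) \<longleftrightarrow>
    ((\<lambda>x. real_part (f x)) has_real_derivative real_part d) (at x within S) \<and>
    ((\<lambda>x. dual_part (f x)) has_real_derivative dual_part d) (at x within S)"
  (is "?L \<longleftrightarrow> ?R")
proof
  assume ?L
  then show ?R
    unfolding has_real_derivative_iff_has_vector_derivative
    using bounded_linear.has_vector_derivative [OF bounded_linear_real_part]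
      bounded_linear.has_vector_derivative [OF bounded_linear_dual_part] by blast
next
  assume ?R
  then have "((\<lambda>x. (real_part (f x), dual_part (f x))) has_vector_derivative
      (real_part d, dual_part d)) (at x within S)"
    unfolding has_real_derivative_iff_has_vector_derivative
    by (intro has_vector_derivative_Pair) auto
  from bounded_linear.has_vector_derivative [OF bounded_linear_Dual this] show ?L
    by simp
qed

lemma has_vector_derivative_dual_cos:
  assumes "(f has_vector_derivative p) (at x within S)"
  shows "((\<lambda>x. dual_cos (f x)) has_vector_derivative - dual_sin (f x) * p) (at x within S)"
  using assms unfolding has_vector_derivative_dual_iff dual_cos_def dual_sin_def
  by (auto intro!: derivative_eq_intros simp: algebra_simps)

lemma has_vector_derivative_dual_sin:
  assumes "(f has_vector_derivative p) (at x within S)"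
  shows "((\<lambda>x. dual_sin (f x)) has_vector_derivative dual_cos (f x) * p) (at x within S)"
  using assms unfolding has_vector_derivative_dual_iff dual_cos_def dual_sin_def
  by (auto intro!: derivative_eq_intros simp: algebra_simps)

lemma dual_cos_sin_squares: "dual_cos x * dual_cos x + dual_sin x * dual_sin x = 1"
  using sin_cos_squared_add3 [of "real_part x"]
  by (simp add: dual_eq_iff dual_cos_def dual_sin_def)

lemma invertible_if_not_pure_dual:
  assumes "\<not> pure_dual x"
  obtains y where "x * y = 1"
proof
  show "x * Dual (1 / real_part x) (- dual_part x / (real_part x)\<^sup>2) = 1"
    using assms by (simp add: pure_dual_def dual_eq_iff power2_eq_square)
qed

lemma dual_inner_coordinates: "dual_inner v w = v $ 1 * w $ 1 + v $ 2 * w $ 2 + v $ 3 * w $ 3"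
  by (simp add: dual_inner_def dual_eq_iff inner_vec_def sum_3 vec_real_part_def vec_dual_part_def)

lemma dual_inner_commute: "dual_inner v w = dual_inner w v"
  by (simp add: dual_inner_coordinates algebra_simps)

lemma dual_inner_add_left: "dual_inner (u + v) w = dual_inner u w + dual_inner v w"
  by (simp add: dual_inner_coordinates algebra_simps)

lemma dual_inner_scale_left: "dual_inner (c *s v) w = c * dual_inner v w"
  by (simp add: dual_inner_coordinates algebra_simps)

lemmas dual_inner_left = dual_inner_add_left dual_inner_scale_left

lemma dual_inner_cross_left: "dual_inner v (dual_cross v w) = 0"
  by (simp add: dual_inner_coordinates dual_cross_def vector_3 algebra_simps)

lemma dual_inner_cross_right: "dual_inner w (dual_cross v w) = 0"
  by (simp add: dual_inner_coordinates dual_cross_def vector_3 algebra_simps)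

lemma dual_inner_cross_cross:
  "dual_inner (dual_cross v w) (dual_cross v w) =
    dual_inner v v * dual_inner w w - dual_inner v w * dual_inner v w"
  by (simp add: dual_inner_coordinates dual_cross_def vector_3 algebra_simps)

lemma bounded_linear_dual_inner_left: "bounded_linear (\<lambda>v. dual_inner v w)"
  unfolding dual_inner_coordinates
  by (intro bounded_linear_add bounded_linear_compose [OF bounded_linear_mult_left]
      bounded_linear_vec_nth)


section \<open>Bertrand curves\<close>

lemma has_dual_derivative_along_path:
  assumes f: "has_dual_derivative f v (\<gamma> r) I"
    and \<gamma>: "(\<gamma> has_vector_derivative d) (at r within S)" "\<gamma> ` S \<subseteq> I"
  shows "((\<lambda>r. dual_inner (f (\<gamma> r)) w) has_vector_derivative d * dual_inner v w) (at r within S)"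
proof -
  have "(f has_derivative (\<lambda>h. h *s v)) (at (\<gamma> r) within \<gamma> ` S)"
    using f \<gamma>(2) unfolding has_dual_derivative_def by (rule has_derivative_subset)
  from vector_derivative_diff_chain_within [OF \<gamma>(1) this]
  have "((\<lambda>r. f (\<gamma> r)) has_vector_derivative d *s v) (at r within S)"
    by (simp add: o_def)
  from bounded_linear.has_vector_derivative [OF bounded_linear_dual_inner_left this]
  show ?thesis
    by (simp add: dual_inner_scale_left)
qed

lemma has_derivative_dual_inner:
  assumes "has_dual_derivative f v s I"
  shows "((\<lambda>s. dual_inner (f s) w) has_derivative (\<lambda>h. h * dual_inner v w)) (at s within I)"
  using bounded_linear.has_derivative [OF bounded_linear_dual_inner_left
      assms [unfolded has_dual_derivative_def]]
  by (simp add: dual_inner_scale_left)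

text \<open>The chain rule substitute applies with \<open>F = \<langle>U, M (t r)\<rangle>\<close>, whose derivative is multiplication
  by the invertible curvature, and \<open>Q = \<langle>U, w\<rangle>\<close>, which is stationary because \<open>w\<close> is orthogonal to
  \<open>N\<close> and \<open>M (t r)\<close> is a multiple of \<open>N\<close>.  Read on the first curve, the derivative of \<open>Q \<circ> t\<close> is
  exactly that of the angle.\<close>

lemma angle_derivative_zero:
  assumes \<alpha>: "dual_frenet_curve I \<alpha> T N B \<kappa> \<tau>"
    and \<beta>: "dual_frenet_curve J \<beta> U M C \<kappa>' \<tau>'"
    and g: "bertrand_correspondence I N J M g"
    and \<phi>: "dual_tangent_angle I T B U g \<phi>"
    and \<gamma>: "(\<gamma> has_vector_derivative d) (at r within S)" "\<gamma> ` S \<subseteq> I" "r \<in> S"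
    and p: "((\<lambda>r. \<phi> (\<gamma> r)) has_vector_derivative p) (at r within S)"
    and x: "\<And>n. x n \<in> S - {r}" "x \<longlonglongrightarrow> r" "(\<lambda>n. g (\<gamma> (x n))) \<longlonglongrightarrow> g (\<gamma> r)"
  shows "p = 0"
proof -
  define s where "s = \<gamma> r"
  define t where "t y = g (\<gamma> y)" for y
  define w where "w = (- dual_sin (\<phi> s)) *s T s + dual_cos (\<phi> s) *s B s"
  have s: "s \<in> I" and ts: "t r = g s" "t r \<in> J" and tJ: "t ` S \<subseteq> J"
    using \<gamma> g by (auto simp: s_def t_def bertrand_correspondence_def)
  have der: "has_dual_derivative T (\<kappa> s *s N s) s I" "has_dual_derivative B (- (\<tau> s) *s N s) s I"
    using \<alpha> s by (auto simp: dual_frenet_curve_def)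
  have \<beta>t: "dual_norm (M (t r)) = 1" "\<not> pure_dual (\<kappa>' (t r))"
      "has_dual_derivative U (\<kappa>' (t r) *s M (t r)) (t r) J"
    using \<beta> ts by (auto simp: dual_frenet_curve_def)
  have TT: "dual_inner (T s) (T s) = 1" and NN: "dual_inner (N s) (N s) = 1"
      and TN: "dual_inner (T s) (N s) = 0" and B: "B s = dual_cross (T s) (N s)"
    using \<alpha> s dual_norm_mult_self [of "T s"] dual_norm_mult_self [of "N s"]
    by (auto simp: dual_frenet_curve_def)
  have BB: "dual_inner (B s) (B s) = 1" and TB: "dual_inner (T s) (B s) = 0"
      and NB: "dual_inner (N s) (B s) = 0"
    using TT NN TN by (simp_all add: B dual_inner_cross_cross dual_inner_cross_left
        dual_inner_cross_right)
  have wl: "dual_inner v w =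
      - dual_sin (\<phi> s) * dual_inner v (T s) + dual_cos (\<phi> s) * dual_inner v (B s)" for v
    by (simp add: w_def dual_inner_coordinates algebra_simps)
  have Tw: "dual_inner (T s) w = - dual_sin (\<phi> s)" and Bw: "dual_inner (B s) w = dual_cos (\<phi> s)"
      and Nw: "dual_inner (N s) w = 0"
    using TT BB TB NB TN dual_inner_commute [of "B s" "T s"] dual_inner_commute [of "N s" "T s"]
    by (simp_all add: wl)
  obtain k where k: "M (t r) = k *s N s"
    using g s ts(1) unfolding bertrand_correspondence_def dual_parallel_def by metis
  have Mw: "dual_inner (M (t r)) w = 0"
    by (simp add: k dual_inner_scale_left Nw)
  have MM: "dual_inner (M (t r)) (M (t r)) = 1"
    using dual_norm_mult_self [of "M (t r)"] \<beta>t(1) by simp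
  obtain i where i: "\<kappa>' (t r) * i = 1"
    using invertible_if_not_pure_dual \<beta>t(2) by blast
  then have "i \<noteq> 0" by auto
  have tangent: "dual_inner (U (t y)) v =
      dual_cos (\<phi> (\<gamma> y)) * dual_inner (T (\<gamma> y)) v + dual_sin (\<phi> (\<gamma> y)) * dual_inner (B (\<gamma> y)) v"
    if "y \<in> S" for y v
    using \<phi> that \<gamma>(2) by (auto simp: t_def dual_tangent_angle_def dual_inner_left)
  define D where "D v =
      dual_cos (\<phi> s) * (d * dual_inner (\<kappa> s *s N s) v) + - dual_sin (\<phi> s) * p * dual_inner (T s) v +
      (dual_sin (\<phi> s) * (d * dual_inner (- (\<tau> s) *s N s) v) + dual_cos (\<phi> s) * p * dual_inner (B s) v)"
    for v
  have tangent_der: "((\<lambda>y. dual_inner (U (t y)) v) has_vector_derivative D v) (at r within S)" for v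
  proof (rule has_vector_derivative_transform [OF \<open>r \<in> S\<close> tangent])
    show "((\<lambda>y. dual_cos (\<phi> (\<gamma> y)) * dual_inner (T (\<gamma> y)) v +
        dual_sin (\<phi> (\<gamma> y)) * dual_inner (B (\<gamma> y)) v) has_vector_derivative D v) (at r within S)"
      unfolding D_def s_def
      by (intro has_vector_derivative_add has_vector_derivative_mult
          has_vector_derivative_dual_cos has_vector_derivative_dual_sin p
          has_dual_derivative_along_path [OF _ \<gamma>(1,2)] der [unfolded s_def])
  qed
  \<comment> \<open>\<open>w\<close> is the derivative of \<open>cos \<phi> T + sin \<phi> B\<close> with respect to \<open>\<phi>\<close>, a unit vector orthogonal
    to \<open>N\<close>, so the terms coming from \<open>T'\<close> and \<open>B'\<close> disappear.\<close>
  have Dw: "D w = p"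
  proof -
    have "D w = (dual_cos (\<phi> s) * dual_cos (\<phi> s) + dual_sin (\<phi> s) * dual_sin (\<phi> s)) * p"
      unfolding D_def dual_inner_scale_left Tw Bw Nw by (simp add: algebra_simps)
    then show ?thesis
      by (simp add: dual_cos_sin_squares)
  qed
  show ?thesis
  proof (rule vector_derivative_zero_of_stationary_composition)
    show "((\<lambda>u. dual_inner (U u) (M (t r))) has_derivative (\<lambda>h. h * \<kappa>' (t r))) (at (t r) within J)"
      using has_derivative_dual_inner [OF \<beta>t(3), of "M (t r)"]
      by (simp add: dual_inner_scale_left MM)
    show "1 / norm i > 0"
      using \<open>i \<noteq> 0\<close> by simp
    show "1 / norm i * norm h \<le> norm (h * \<kappa>' (t r))" for h
    proof -
      have "h = h * \<kappa>' (t r) * i"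
        using i by (simp add: mult.assoc)
      then have "norm h \<le> norm (h * \<kappa>' (t r)) * norm i"
        by (metis norm_mult_ineq)
      then show ?thesis
        using \<open>i \<noteq> 0\<close> by (simp add: field_simps)
    qed
    show "((\<lambda>u. dual_inner (U u) w) has_derivative (\<lambda>h. 0)) (at (t r) within J)"
      using has_derivative_dual_inner [OF \<beta>t(3), of w] by (simp add: dual_inner_scale_left Mw)
    show "((\<lambda>y. dual_inner (U (t y)) (M (t r))) has_vector_derivative D (M (t r))) (at r within S)"
      by (rule tangent_der)
    show "((\<lambda>y. dual_inner (U (t y)) w) has_vector_derivative p) (at r within S)"
      using tangent_der [of w] by (simp add: Dw)
    show "\<And>n. x n \<in> S - {r}" "x \<longlonglongrightarrow> r" "(\<lambda>n. t (x n)) \<longlonglongrightarrow> t r"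
      using x by (simp_all add: t_def)
  qed (rule tJ)
qed

text \<open>The exceptional set consists of the corners of the path and of the parameters at which the
  graph of the correspondence has an isolated point; it is countable.\<close>

lemma angle_constant_along_path:
  assumes \<alpha>: "dual_frenet_curve I \<alpha> T N B \<kappa> \<tau>"
    and \<beta>: "dual_frenet_curve J \<beta> U M C \<kappa>' \<tau>'"
    and g: "bertrand_correspondence I N J M g"
    and \<phi>: "dual_tangent_angle I T B U g \<phi>"
    and \<gamma>: "valid_path \<gamma>" "path_image \<gamma> \<subseteq> I"
  shows "\<phi> (pathfinish \<gamma>) = \<phi> (pathstart \<gamma>)"
proof -
  define f where "f r = \<phi> (\<gamma> r)" for r
  define t where "t r = g (\<gamma> r)" for r
  have \<gamma>I: "\<gamma> ` {0..1} \<subseteq> I"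
    using \<gamma>(2) by (simp add: path_image_def)
  obtain K where K: "finite K" "\<gamma> C1_differentiable_on ({0..1} - K)"
    using \<gamma>(1) by (auto simp: valid_path_def piecewise_C1_differentiable_on_def)
  \<comment> \<open>Real coordinates turn the graph of \<open>t\<close> into a subset of a second countable product of lines.\<close>
  define E where
    "E = {r \<in> {0..1}. \<not> graph_accumulates (\<lambda>r. (real_part (t r), dual_part (t r))) {0..1} r}"
  have E: "countable E"
    unfolding E_def by (rule countable_no_graph_accumulation)
  have cont: "continuous_on {0..1} f"
    unfolding f_def
  proof (rule continuous_on_compose2 [OF _ _ \<gamma>I])
    show "continuous_on I \<phi>"
      using \<phi> by (simp add: dual_tangent_angle_def differentiable_imp_continuous_on)
    show "continuous_on {0..1} \<gamma>"
      using valid_path_imp_path [OF \<gamma>(1)] by (simp add: path_def)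
  qed
  have "(f has_vector_derivative 0) (at r within {0..1})" if r: "r \<in> {0..1} - (K \<union> E)" for r
  proof -
    obtain d where "(\<gamma> has_vector_derivative d) (at r)"
      using K(2) r unfolding C1_differentiable_on_def by (metis DiffE DiffI UnI1)
    then have d: "(\<gamma> has_vector_derivative d) (at r within {0..1})"
      by (rule has_vector_derivative_at_within)
    obtain \<phi>' where "(\<phi> has_derivative \<phi>') (at (\<gamma> r) within I)"
      using \<phi> \<gamma>I r unfolding dual_tangent_angle_def differentiable_on_def differentiable_def by blast
    then have "(\<phi> has_derivative \<phi>') (at (\<gamma> r) within \<gamma> ` {0..1})"
      using \<gamma>I by (rule has_derivative_subset)
    from vector_derivative_diff_chain_within [OF d this]
    have f': "((\<lambda>r. \<phi> (\<gamma> r)) has_vector_derivative \<phi>' d) (at r within {0..1})"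
      by (simp add: o_def)
    have "graph_accumulates (\<lambda>r. (real_part (t r), dual_part (t r))) {0..1} r"
      using r by (simp add: E_def)
    then obtain x where x: "\<forall>n. x n \<in> {0..1} - {r}" "x \<longlonglongrightarrow> r"
      "(\<lambda>n. (real_part (t (x n)), dual_part (t (x n)))) \<longlonglongrightarrow> (real_part (t r), dual_part (t r))"
      unfolding graph_accumulates_def by blast
    have "(\<lambda>n. g (\<gamma> (x n))) \<longlonglongrightarrow> g (\<gamma> r)"
      using tendsto_Dual [OF tendsto_fst [OF x(3)] tendsto_snd [OF x(3)]] by (simp add: t_def)
    with x r have "\<phi>' d = 0"
      by (intro angle_derivative_zero [OF \<alpha> \<beta> g \<phi> d \<gamma>I _ f']) auto
    with f' show ?thesis by (simp add: f_def [abs_def])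
  qed
  then have der: "((\<lambda>r. real_part (f r)) has_real_derivative 0) (at r within {0..1})"
      "((\<lambda>r. dual_part (f r)) has_real_derivative 0) (at r within {0..1})"
    if "r \<in> {0..1} - (K \<union> E)" for r
    using that by (simp_all add: has_vector_derivative_dual_iff)
  have KE: "countable (K \<union> E)"
    using K(1) E by (simp add: countable_finite)
  have "real_part (f 1) = real_part (f 0)"
    by (rule eq_if_derivative_zero_off_countable [OF _ _ KE der(1)])
      (auto intro: bounded_linear.continuous_on [OF bounded_linear_real_part] cont)
  moreover have "dual_part (f 1) = dual_part (f 0)"
    by (rule eq_if_derivative_zero_off_countable [OF _ _ KE der(2)])
      (auto intro: bounded_linear.continuous_on [OF bounded_linear_dual_part] cont)
  ultimately show ?thesis
    by (simp add: f_def pathstart_def pathfinish_def dual_eq_iff)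
qed

theorem theorem2:
  fixes I J :: "dual set"
    and \<alpha> \<beta> T N B T\<^sub>\<beta> N\<^sub>\<beta> B\<^sub>\<beta> :: "dual \<Rightarrow> dual ^ 3"
    and \<kappa> \<tau> \<kappa>\<^sub>\<beta> \<tau>\<^sub>\<beta> g \<phi> :: "dual \<Rightarrow> dual"
  assumes "dual_frenet_curve I \<alpha> T N B \<kappa> \<tau>"
    and "dual_frenet_curve J \<beta> T\<^sub>\<beta> N\<^sub>\<beta> B\<^sub>\<beta> \<kappa>\<^sub>\<beta> \<tau>\<^sub>\<beta>"
    and "bertrand_correspondence I N J N\<^sub>\<beta> g"
    and "dual_tangent_angle I T B T\<^sub>\<beta> g \<phi>"
  shows "\<phi> constant_on I"
proof -
  have "\<phi> y = \<phi> x" if "x \<in> I" "y \<in> I" for x y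
  proof -
    obtain \<gamma> where "valid_path \<gamma>" "path_image \<gamma> \<subseteq> I" "pathstart \<gamma> = x" "pathfinish \<gamma> = y"
      using assms(1) \<open>x \<in> I\<close> \<open>y \<in> I\<close> unfolding dual_frenet_curve_def dual_domain_def by metis
    then show ?thesis
      using angle_constant_along_path [OF assms] by metis
  qed
  then show ?thesis
    unfolding constant_on_def by metis
qed

end
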